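(* (1) The hyperbolic rotations $X_0=y\frac{\partial}{\partial x}+x\frac{\partial}{\partial y}$ and the reflections $\varepsilon^1:(x,y,z)\mapsto(x,-y,z)$, $\varepsilon^2:(x,y,z)\mapsto(x,y,-z)$ preserve $d(\cdot)$; that is, $d(e^{sX_0}(q))=d(q)$ for all $s\in\mathbb R$, $q\in J^+(q_0)$, and $d(\varepsilon^i(q))=d(q)$ for $i=1,2$, $q\in J^+(q_0)$. (2) The dilations $Y=x\frac{\partial}{\partial x}+y\frac{\partial}{\partial y}+2z\frac{\partial}{\partial z}$ stretch $d(\cdot)$: $$d(e^{sY}(q))=e^sd(q),\qquad s\in\mathbb R,\quad q\in J^+(q_0).$$
   Context: $M=\mathbb R^3_{x,y,z}$ is the Heisenberg group with product $(x_1,y_1,z_1)\cdot(x_2,y_2,z_2)=(x_1+x_2,\,y_1+y_2,\,z_1+z_2+(x_1y_2-x_2y_1)/2)$, $q_0=(0,0,0)$, $X_1=\frac{\partial}{\partial x}-\frac y2\frac{\partial}{\partial z}$, $X_2=\frac{\partial}{\partial y}+\frac x2\frac{\partial}{\partial z}$. Admissible trajectories are Lipschitz curves $q:[0,t_1]\to M$ with $\dot q=u_1X_1(q)+u_2X_2(q)$, $u_1\ge|u_2|$ a.e.; their length is $l(q(\cdot))=\int_0^{t_1}\sqrt{u_1^2-u_2^2}\,dt$. The causal future $J^+(q_0)$ is the set of points reachable from $q_0$ (in nonnegative time) by admissible trajectories; it is known that $J^+(q_0)=\{-x^2+y^2+4|z|\le0,\ x\ge0\}$. For $q\in J^+(q_0)$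 the sub-Lorentzian distance $d(q)=d(q_0,q)$ is the supremum of $l$ over all admissible trajectories from $q_0$ to $q$ ($d(q_0)=0$). For a vector field $V$, $e^{sV}$ denotes its flow at time $s$; explicitly $e^{sX_0}(x,y,z)=(x\cosh s+y\sinh s,\ x\sinh s+y\cosh s,\ z)$ and $e^{sY}(x,y,z)=(xe^s,ye^s,ze^{2s})$. *)

theory Defs
  imports "HOL-Analysis.Analysis"
begin

type_synonym point = "real \<times> real \<times> real"

type_synonym vfield = "point \<Rightarrow> point"

abbreviation q0 :: point where "q0 \<equiv> (0, 0, 0)"

definition X1 :: vfield where
  "X1 = (\<lambda>(x, y, z). (1, 0, - y / 2))"

definition X2 :: vfield where
  "X2 = (\<lambda>(x, y, z). (0, 1, x / 2))"

definition X0 :: vfield where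
  "X0 = (\<lambda>(x, y, z). (y, x, 0))"

definition Y :: vfield where
  "Y = (\<lambda>(x, y, z). (x, y, 2 * z))"

definition refl1 :: "point \<Rightarrow> point" where
  "refl1 = (\<lambda>(x, y, z). (x, - y, z))"

definition refl2 :: "point \<Rightarrow> point" where
  "refl2 = (\<lambda>(x, y, z). (x, y, - z))"

(* Integral curves are required on all of the real line, so this is the flow of complete
   fields with unique integral curves; the lemmas flow_X0 and flow_Y below show that
   the two fields used here are of this kind. *)
definition flow :: "vfield \<Rightarrow> real \<Rightarrow> point \<Rightarrow> point" where
  "flow V s q = (THE p. \<exists>c. c 0 = q \<and>
     (\<forall>t. (c has_vector_derivative V (c t)) (at t)) \<and> c s = p)"

(* The controls are determined almost everywhere by the curve, because X1 and X2 are
   linearly independent at every point. *)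
definition admissible ::
  "real \<Rightarrow> (real \<Rightarrow> point) \<Rightarrow> (real \<Rightarrow> real) \<Rightarrow> (real \<Rightarrow> real) \<Rightarrow> bool" where
  "admissible T q u1 u2 \<longleftrightarrow>
     0 \<le> T \<and>
     (\<exists>L. L-lipschitz_on {0..T} q) \<and>
     u1 \<in> borel_measurable (lebesgue_on {0..T}) \<and>
     u2 \<in> borel_measurable (lebesgue_on {0..T}) \<and>
     (AE t in lebesgue_on {0..T}.
        (q has_vector_derivative (u1 t *\<^sub>R X1 (q t) + u2 t *\<^sub>R X2 (q t))) (at t within {0..T}) \<and>
        u1 t \<ge> \<bar>u2 t\<bar>)"

definition traj_length :: "real \<Rightarrow> (real \<Rightarrow> real) \<Rightarrow> (real \<Rightarrow> real) \<Rightarrow> real" where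
  "traj_length T u1 u2 = (LINT t|lebesgue_on {0..T}. sqrt ((u1 t)\<^sup>2 - (u2 t)\<^sup>2))"

definition causal_future :: "point set" where
  "causal_future =
     {p. \<exists>T q u1 u2. admissible T q u1 u2 \<and> q 0 = q0 \<and> q T = p}"

(* The supremum is taken in the extended reals: it is a genuine least upper bound without
   any prior boundedness argument, and it is -\<infinity> exactly off the causal future. *)
definition dist_sL :: "point \<Rightarrow> ereal" where
  "dist_sL p = (if p = q0 then 0 else
     Sup {ereal (traj_length T u1 u2) | T q u1 u2.
            admissible T q u1 u2 \<and> q 0 = q0 \<and> q T = p})"

lemma scalar_linear_ode_unique:
  fixes f :: "real \<Rightarrow> real"
  assumes "\<And>t. (f has_real_derivative k * f t) (at t)"
  shows "f t = f 0 * exp (k * t)"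
proof -
  have "((\<lambda>t. f t * exp (- k * t)) has_real_derivative 0) (at t)" for t
    by (rule derivative_eq_intros assms | simp add: algebra_simps)+
  then have "f t * exp (- k * t) = f 0 * exp (- k * 0)"
    using DERIV_isconst_all[of "\<lambda>t. f t * exp (- k * t)" t 0] by blast
  then have "f t * exp (- k * t) * exp (k * t) = f 0 * exp (k * t)" by simp
  then show ?thesis by (simp add: mult.assoc flip: exp_add)
qed

lemma has_vector_derivative_point_iff:
  "(c has_vector_derivative (a, b, d)) (at t) \<longleftrightarrow>
     ((\<lambda>t. fst (c t)) has_real_derivative a) (at t) \<and>
     ((\<lambda>t. fst (snd (c t))) has_real_derivative b) (at t) \<and>
     ((\<lambda>t. snd (snd (c t))) has_real_derivative d) (at t)"
  (is "?L \<longleftrightarrow> ?R")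
proof
  assume L: ?L
  show ?R
    using bounded_linear.has_vector_derivative[OF bounded_linear_fst L]
      bounded_linear.has_vector_derivative[OF bounded_linear_fst
        bounded_linear.has_vector_derivative[OF bounded_linear_snd L]]
      bounded_linear.has_vector_derivative[OF bounded_linear_snd
        bounded_linear.has_vector_derivative[OF bounded_linear_snd L]]
    by (simp add: has_real_derivative_iff_has_vector_derivative)
next
  assume ?R
  then have "((\<lambda>t. (fst (c t), fst (snd (c t)), snd (snd (c t))))
      has_vector_derivative (a, b, d)) (at t)"
    by (intro has_vector_derivative_Pair)
       (auto simp: has_real_derivative_iff_has_vector_derivative)
  then show ?L by simp
qed

lemma flow_eqI:
  assumes "c 0 = q" and "\<And>t. (c has_vector_derivative V (c t)) (at t)"
    and "\<And>b. b 0 = q \<Longrightarrow> (\<And>t. (b has_vector_derivative V (b t)) (at t)) \<Longrightarrow> b s = c s"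
  shows "flow V s q = c s"
  unfolding flow_def by (rule the_equality) (use assms in blast)+

lemma flow_X0:
  "flow X0 s (x, y, z) = (x * cosh s + y * sinh s, x * sinh s + y * cosh s, z)"
proof -
  let ?c = "\<lambda>t. (x * cosh t + y * sinh t, x * sinh t + y * cosh t, z)"
  have "flow X0 s (x, y, z) = ?c s"
  proof (rule flow_eqI)
    show "(?c has_vector_derivative X0 (?c t)) (at t)" for t
      unfolding X0_def prod.case has_vector_derivative_point_iff
      by (auto intro!: derivative_eq_intros)
  next
    fix b :: "real \<Rightarrow> point"
    assume b0: "b 0 = (x, y, z)" and b: "\<And>t. (b has_vector_derivative X0 (b t)) (at t)"
    define f g h where "f = (\<lambda>t. fst (b t))" and "g = (\<lambda>t. fst (snd (b t)))"
      and "h = (\<lambda>t. snd (snd (b t)))"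
    have d: "(f has_real_derivative g t) (at t)" "(g has_real_derivative f t) (at t)"
      "(h has_real_derivative 0 * h t) (at t)" for t
      using b[of t]
      by (auto simp: X0_def case_prod_beta has_vector_derivative_point_iff f_def g_def h_def)
    have p: "((\<lambda>t. f t + g t) has_real_derivative 1 * (f t + g t)) (at t)" for t
      by (rule derivative_eq_intros d | simp)+
    have m: "((\<lambda>t. f t - g t) has_real_derivative (-1) * (f t - g t)) (at t)" for t
      by (rule derivative_eq_intros d | simp)+
    have i: "f 0 = x" "g 0 = y" "h 0 = z" using b0 by (auto simp: f_def g_def h_def)
    have "f s + g s = (x + y) * exp s" "f s - g s = (x - y) * exp (- s)" "h s = z"
      using scalar_linear_ode_unique[OF p, of s] scalar_linear_ode_unique[OF m, of s]
        scalar_linear_ode_unique[OF d(3), of s] i by auto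
    then have "f s = x * cosh s + y * sinh s" "g s = x * sinh s + y * cosh s" "h s = z"
      by (auto simp: cosh_def sinh_def field_simps)
    then show "b s = ?c s" by (simp add: f_def g_def h_def prod_eq_iff)
  qed simp
  then show ?thesis .
qed

lemma flow_Y:
  "flow Y s (x, y, z) = (x * exp s, y * exp s, z * exp (2 * s))"
proof -
  let ?c = "\<lambda>t. (x * exp t, y * exp t, z * exp (2 * t))"
  have "flow Y s (x, y, z) = ?c s"
  proof (rule flow_eqI)
    show "(?c has_vector_derivative Y (?c t)) (at t)" for t
      unfolding Y_def prod.case has_vector_derivative_point_iff
      by (auto intro!: derivative_eq_intros)
  next
    fix b :: "real \<Rightarrow> point"
    assume b0: "b 0 = (x, y, z)" and b: "\<And>t. (b has_vector_derivative Y (b t)) (at t)"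
    define f g h where "f = (\<lambda>t. fst (b t))" and "g = (\<lambda>t. fst (snd (b t)))"
      and "h = (\<lambda>t. snd (snd (b t)))"
    have d: "(f has_real_derivative 1 * f t) (at t)" "(g has_real_derivative 1 * g t) (at t)"
      "(h has_real_derivative 2 * h t) (at t)" for t
      using b[of t]
      by (auto simp: Y_def case_prod_beta has_vector_derivative_point_iff f_def g_def h_def)
    have i: "f 0 = x" "g 0 = y" "h 0 = z" using b0 by (auto simp: f_def g_def h_def)
    show "b s = ?c s"
      using scalar_linear_ode_unique[OF d(1), of s] scalar_linear_ode_unique[OF d(2), of s]
        scalar_linear_ode_unique[OF d(3), of s] i
      by (simp add: f_def g_def h_def prod_eq_iff)
  qed simp
  then show ?thesis .
qed

end

theory Submission
  imports Defs
begin

text \<open>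
  Each symmetry is implemented on trajectories. A linear map of the horizontal plane lifts to a
  group automorphism of the Heisenberg group, acting on \<open>z\<close> by its determinant; it acts on the
  controls by the same linear map. Hyperbolic rotations, dilations and \<open>\<epsilon>\<^sup>1 \<circ> \<epsilon>\<^sup>2\<close> arise in
  this way. The reflection \<open>\<epsilon>\<^sup>2\<close> is not an automorphism: it is obtained by running a trajectory
  from \<open>q0\<close> to \<open>p\<close> backwards, left translating by the inverse of \<open>p\<close> and applying the automorphism
  \<open>(x, y, z) \<mapsto> (- x, - y, z)\<close>. Finally \<open>\<epsilon>\<^sup>1 = (\<epsilon>\<^sup>1 \<circ> \<epsilon>\<^sup>2) \<circ> \<epsilon>\<^sup>2\<close>. All these operations are
  invertible, so an inequality between distances in one direction suffices.
\<close>

section \<open>Lengths of trajectories and comparison of distances\<close>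

definition traj_lengths :: "point \<Rightarrow> real set" where
  "traj_lengths p = {traj_length T u1 u2 | T q u1 u2. admissible T q u1 u2 \<and> q 0 = q0 \<and> q T = p}"

lemma dist_sL_eq_Sup: "dist_sL p = (if p = q0 then 0 else Sup (ereal ` traj_lengths p))"
proof -
  have "{ereal (traj_length T u1 u2) | T q u1 u2. admissible T q u1 u2 \<and> q 0 = q0 \<and> q T = p}
      = ereal ` traj_lengths p"
    unfolding traj_lengths_def by blast
  then show ?thesis by (simp add: dist_sL_def)
qed

text \<open>Dividing by \<open>k > 0\<close> moves the factor off the supremum, so the bound can be
  checked length by length. Hypothesis \<open>z\<close> puts both points in the same branch of
  \<open>dist_sL\<close>, whose value at \<open>q0\<close> is set by definition and not by the
  supremum.\<close>

lemma dist_sL_scale_le: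
  assumes k: "k > 0" and z: "p = q0 \<longleftrightarrow> p' = q0"
    and l: "\<And>l. l \<in> traj_lengths p \<Longrightarrow> k * l \<in> traj_lengths p'"
  shows "ereal k * dist_sL p \<le> dist_sL p'"
proof (cases "p = q0")
  case False
  have "Sup (ereal ` traj_lengths p) \<le> Sup (ereal ` traj_lengths p') / ereal k"
  proof (rule SUP_least)
    fix r assume "r \<in> traj_lengths p"
    then have "ereal (k * r) \<le> Sup (ereal ` traj_lengths p')"
      by (intro SUP_upper l)
    then show "ereal r \<le> Sup (ereal ` traj_lengths p') / ereal k"
      using k by (simp add: ereal_le_divide_pos)
  qed
  then show ?thesis
    using k z False by (simp add: dist_sL_eq_Sup ereal_le_divide_pos)
qed (use z in \<open>simp add: dist_sL_eq_Sup\<close>)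

section \<open>Lifts of linear maps of the plane, acting on trajectories\<close>

definition lift :: "real \<Rightarrow> real \<Rightarrow> real \<Rightarrow> real \<Rightarrow> point \<Rightarrow> point" where
  "lift a b c d = (\<lambda>(x, y, z). (a * x + b * y, c * x + d * y, (a * d - b * c) * z))"

lemma bounded_linear_lift: "bounded_linear (lift a b c d)"
  by (intro linear_conv_bounded_linear[THEN iffD1] linearI)
     (auto simp: lift_def algebra_simps)

text \<open>The z-component of a horizontal vector is half the area form of position and velocity,
  \<open>(x * u2 - y * u1) / 2\<close>, and a planar linear map multiplies this form by its
  determinant.\<close>

lemma lift_horizontal:
  "lift a b c d (u1 *\<^sub>R X1 q + u2 *\<^sub>R X2 q)
    = (a * u1 + b * u2) *\<^sub>R X1 (lift a b c d q) + (c * u1 + d * u2) *\<^sub>R X2 (lift a b c d q)"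
  by (cases q) (simp add: lift_def X1_def X2_def field_simps)

lemma lipschitz_on_bounded_linear_compose:
  assumes "bounded_linear f" "L-lipschitz_on S q"
  shows "\<exists>L. L-lipschitz_on S (\<lambda>t. f (q t))"
  using bounded_linear.lipschitz_boundE[OF assms(1)] lipschitz_on_compose2[OF assms(2)] by metis

lemma traj_length_cong_AE:
  assumes "u1 \<in> borel_measurable (lebesgue_on {0..T})" "u2 \<in> borel_measurable (lebesgue_on {0..T})"
    "v1 \<in> borel_measurable (lebesgue_on {0..T})" "v2 \<in> borel_measurable (lebesgue_on {0..T})"
    and "AE t in lebesgue_on {0..T}. (v1 t)\<^sup>2 - (v2 t)\<^sup>2 = k\<^sup>2 * ((u1 t)\<^sup>2 - (u2 t)\<^sup>2)"
    and "k \<ge> 0"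
  shows "traj_length T v1 v2 = k * traj_length T u1 u2"
proof -
  have "traj_length T v1 v2 = (LINT t|lebesgue_on {0..T}. k * sqrt ((u1 t)\<^sup>2 - (u2 t)\<^sup>2))"
    unfolding traj_length_def
  proof (rule integral_cong_AE)
    \<comment> \<open>\<open>sqrt\<close> is extended to negative arguments as an odd function,
      hence multiplicative on all reals; \<open>sqrt (k^2)\<close> is \<open>k\<close> because
      \<open>k \<ge> 0\<close>.\<close>
    show "AE t in lebesgue_on {0..T}. sqrt ((v1 t)\<^sup>2 - (v2 t)\<^sup>2) = k * sqrt ((u1 t)\<^sup>2 - (u2 t)\<^sup>2)"
      using assms(5) by eventually_elim (simp add: real_sqrt_mult \<open>k \<ge> 0\<close>)
  qed (use assms(1-4) in measurable)
  then show ?thesis by (simp add: traj_length_def)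
qed

text \<open>\<open>cone\<close> keeps the transformed controls in the future cone, so the image
  curve is admissible. \<open>conf\<close> makes the planar map conformal for the Lorentz form, so
  the integrand of the length gains the factor \<open>k\<close>.\<close>

lemma traj_lengths_lift:
  assumes cone: "\<And>u v. u \<ge> \<bar>v\<bar> \<Longrightarrow> a * u + b * v \<ge> \<bar>c * u + d * v\<bar>"
    and conf: "\<And>u v. (a * u + b * v)\<^sup>2 - (c * u + d * v)\<^sup>2 = k\<^sup>2 * (u\<^sup>2 - v\<^sup>2)"
    and k: "k \<ge> 0" and r: "r \<in> traj_lengths p"
  shows "k * r \<in> traj_lengths (lift a b c d p)"
proof -
  obtain T q u1 u2 L where T: "0 \<le> T" and L: "L-lipschitz_on {0..T} q"
    and u: "u1 \<in> borel_measurable (lebesgue_on {0..T})" "u2 \<in> borel_measurable (lebesgue_on {0..T})"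
    and ae: "AE t in lebesgue_on {0..T}.
        (q has_vector_derivative (u1 t *\<^sub>R X1 (q t) + u2 t *\<^sub>R X2 (q t))) (at t within {0..T}) \<and>
        u1 t \<ge> \<bar>u2 t\<bar>"
    and q: "q 0 = q0" "q T = p" and r_eq: "r = traj_length T u1 u2"
    using r unfolding traj_lengths_def admissible_def by blast
  let ?q = "\<lambda>t. lift a b c d (q t)"
  let ?v1 = "\<lambda>t. a * u1 t + b * u2 t" and ?v2 = "\<lambda>t. c * u1 t + d * u2 t"
  have v: "?v1 \<in> borel_measurable (lebesgue_on {0..T})" "?v2 \<in> borel_measurable (lebesgue_on {0..T})"
    using u by measurable
  have "AE t in lebesgue_on {0..T}.
        (?q has_vector_derivative (?v1 t *\<^sub>R X1 (?q t) + ?v2 t *\<^sub>R X2 (?q t))) (at t within {0..T}) \<and>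
        ?v1 t \<ge> \<bar>?v2 t\<bar>"
    using ae
  proof eventually_elim
    case (elim t)
    then show ?case
      using bounded_linear.has_vector_derivative[OF bounded_linear_lift, of q _ _ a b c d] cone
      by (fastforce simp flip: lift_horizontal)
  qed
  then have "admissible T ?q ?v1 ?v2"
    unfolding admissible_def
    using T v lipschitz_on_bounded_linear_compose[OF bounded_linear_lift L] by blast
  moreover have "traj_length T ?v1 ?v2 = k * r"
    unfolding r_eq by (rule traj_length_cong_AE[OF u v _ k]) (simp add: conf)
  moreover have "?q 0 = q0" "?q T = lift a b c d p"
    by (simp_all add: q lift_def)
  ultimately show ?thesis
    unfolding traj_lengths_def by (smt (verit) mem_Collect_eq)
qed

section \<open>Time reversal\<close>

lemma measurable_lebesgue_on_reflect:
  fixes T :: real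
  shows "(\<lambda>t. T - t) \<in> lebesgue_on {0..T} \<rightarrow>\<^sub>M lebesgue_on {0..T}"
  using lebesgue_affine_measurable[of "\<lambda>_. -1" T]
  by (intro measurable_restrict_space3) (auto simp: algebra_simps)

text \<open>Reflection preserves Lebesgue measure on the line and maps the interval onto itself.
  This carries both the almost-everywhere equation and the length integral over to reversed
  curves.\<close>

lemma distr_lebesgue_on_reflect:
  fixes T :: real
  shows "distr (lebesgue_on {0..T}) (lebesgue_on {0..T}) (\<lambda>t. T - t) = lebesgue_on {0..T}"
proof (rule measure_eqI)
  have leb: "distr lebesgue lebesgue (\<lambda>t. T - t) = lebesgue"
    using lebesgue_real_affine[of "-1" T] by (simp add: density_1)
  have meas: "(\<lambda>t. T - t) \<in> lebesgue \<rightarrow>\<^sub>M lebesgue"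
    using lebesgue_affine_measurable[of "\<lambda>_. -1" T] by (simp add: algebra_simps)
  fix A assume "A \<in> sets (distr (lebesgue_on {0..T}) (lebesgue_on {0..T}) (\<lambda>t. T - t))"
  then have A: "A \<in> sets (lebesgue_on {0..T})" by simp
  then have A': "A \<in> sets lebesgue" "A \<subseteq> {0..T}"
    by (auto simp: sets_restrict_space_iff)
  have "emeasure (distr (lebesgue_on {0..T}) (lebesgue_on {0..T}) (\<lambda>t. T - t)) A
      = emeasure (lebesgue_on {0..T}) ((\<lambda>t. T - t) -` A \<inter> {0..T})"
    using A by (simp add: emeasure_distr[OF measurable_lebesgue_on_reflect])
  also have "(\<lambda>t. T - t) -` A \<inter> {0..T} = (\<lambda>t. T - t) -` A"
    using A' by auto
  also have "emeasure (lebesgue_on {0..T}) ((\<lambda>t. T - t) -` A) = emeasure lebesgue ((\<lambda>t. T - t) -` A)"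
    using A' by (intro emeasure_restrict_space) auto
  also have "\<dots> = emeasure (distr lebesgue lebesgue (\<lambda>t. T - t)) A"
    using A' meas by (simp add: emeasure_distr)
  also have "\<dots> = emeasure (lebesgue_on {0..T}) A"
    using A' by (simp add: leb emeasure_restrict_space)
  finally show "emeasure (distr (lebesgue_on {0..T}) (lebesgue_on {0..T}) (\<lambda>t. T - t)) A
      = emeasure (lebesgue_on {0..T}) A" .
qed simp

lemma AE_lebesgue_on_reflect:
  fixes T :: real
  assumes "AE t in lebesgue_on {0..T}. P t"
  shows "AE t in lebesgue_on {0..T}. P (T - t)"
  using AE_distrD[OF measurable_lebesgue_on_reflect, of P T] assms
  unfolding distr_lebesgue_on_reflect .

text \<open>The left translation by the inverse of \<open>(a, b, c)\<close>, followed by the automorphism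
  \<open>(x, y, z) \<mapsto> (- x, - y, z)\<close>, is \<open>q \<mapsto> (a, b, - c) + reversal_linear a b q\<close>.\<close>

definition reversal_linear :: "real \<Rightarrow> real \<Rightarrow> point \<Rightarrow> point" where
  "reversal_linear a b = (\<lambda>(x, y, z). (- x, - y, z + (b * x - a * y) / 2))"

lemma bounded_linear_reversal_linear: "bounded_linear (reversal_linear a b)"
  by (intro linear_conv_bounded_linear[THEN iffD1] linearI)
     (auto simp: reversal_linear_def field_simps)

text \<open>The minus sign is the one that the chain rule produces for
  \<open>t \<mapsto> T - t\<close>. The term \<open>(b * x - a * y) / 2\<close> compensates the
  shift of the base point by \<open>(a, b)\<close>; \<open>c\<close> is arbitrary because
  \<open>X1\<close> and \<open>X2\<close> do not depend on z.\<close>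

lemma reversal_horizontal:
  "- reversal_linear a b (u1 *\<^sub>R X1 q + u2 *\<^sub>R X2 q)
    = u1 *\<^sub>R X1 ((a, b, c) + reversal_linear a b q) + u2 *\<^sub>R X2 ((a, b, c) + reversal_linear a b q)"
  by (cases q) (simp add: reversal_linear_def X1_def X2_def field_simps)

lemma traj_lengths_refl2:
  assumes "r \<in> traj_lengths p"
  shows "r \<in> traj_lengths (refl2 p)"
proof -
  obtain T q u1 u2 L where T: "0 \<le> T" and L: "L-lipschitz_on {0..T} q"
    and u: "u1 \<in> borel_measurable (lebesgue_on {0..T})" "u2 \<in> borel_measurable (lebesgue_on {0..T})"
    and ae: "AE t in lebesgue_on {0..T}.
        (q has_vector_derivative (u1 t *\<^sub>R X1 (q t) + u2 t *\<^sub>R X2 (q t))) (at t within {0..T}) \<and>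
        u1 t \<ge> \<bar>u2 t\<bar>"
    and q: "q 0 = q0" "q T = p" and r_eq: "r = traj_length T u1 u2"
    using assms unfolding traj_lengths_def admissible_def by blast
  obtain a b c where p: "p = (a, b, c)" by (cases p)
  \<comment> \<open>The linear part sends \<open>p\<close> to \<open>(- a, - b, c)\<close> and fixes
    \<open>q0\<close>, so the new curve runs from \<open>q0\<close> to \<open>(a, b, - c)\<close>,
    which is \<open>refl2 p\<close>. The sign changes from reversing time and from the automorphism
    cancel, so the controls are only reparametrized and stay in the cone.\<close>
  let ?q = "\<lambda>t. (a, b, - c) + reversal_linear a b (q (T - t))"
  let ?v1 = "\<lambda>t. u1 (T - t)" and ?v2 = "\<lambda>t. u2 (T - t)"
  note refl = measurable_lebesgue_on_reflect[of T]
  have v: "?v1 \<in> borel_measurable (lebesgue_on {0..T})" "?v2 \<in> borel_measurable (lebesgue_on {0..T})"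
    using measurable_compose[OF refl u(1)] measurable_compose[OF refl u(2)] by simp_all
  have img: "(\<lambda>t. T - t) ` {0..T} = {0..T}"
    by (auto simp: image_iff intro!: bexI[of _ "T - _"])
  have "1-lipschitz_on {0..T} (\<lambda>t. T - t)"
    by (auto simp: lipschitz_on_def dist_real_def)
  then have "(L * 1)-lipschitz_on {0..T} (\<lambda>t. q (T - t))"
    by (rule lipschitz_on_compose2) (simp add: img L)
  from lipschitz_on_bounded_linear_compose[OF bounded_linear_reversal_linear this]
  have lip: "\<exists>L. L-lipschitz_on {0..T} ?q"
    by (auto simp: lipschitz_on_def)
  have "AE t in lebesgue_on {0..T}. t \<in> {0..T}"
    using AE_space[of "lebesgue_on {0..T}"] by simp
  with AE_lebesgue_on_reflect[OF ae]
  have "AE t in lebesgue_on {0..T}.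
        (?q has_vector_derivative (?v1 t *\<^sub>R X1 (?q t) + ?v2 t *\<^sub>R X2 (?q t))) (at t within {0..T}) \<and>
        ?v1 t \<ge> \<bar>?v2 t\<bar>"
  proof eventually_elim
    case (elim t)
    let ?D = "u1 (T - t) *\<^sub>R X1 (q (T - t)) + u2 (T - t) *\<^sub>R X2 (q (T - t))"
    have "((\<lambda>t. T - t) has_vector_derivative - 1) (at t within {0..T})"
      by (auto intro!: derivative_eq_intros)
    moreover have "(q has_vector_derivative ?D) (at (T - t) within (\<lambda>t. T - t) ` {0..T})"
      using elim by (simp add: img)
    ultimately have "((\<lambda>t. q (T - t)) has_vector_derivative (- ?D)) (at t within {0..T})"
      using vector_diff_chain_within[of "\<lambda>t. T - t" "- 1" t "{0..T}" q ?D] by (simp add: o_def)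
    from bounded_linear.has_vector_derivative[OF bounded_linear_reversal_linear this, of a b]
    have "(?q has_vector_derivative (- reversal_linear a b ?D)) (at t within {0..T})"
      unfolding linear_neg[OF bounded_linear.linear[OF bounded_linear_reversal_linear]]
      by (simp add: has_vector_derivative_add_const add.commute[of "(a, b, - c)"])
    with elim show ?case by (simp only: reversal_horizontal[of _ _ _ _ _ "- c"])
  qed
  with T v lip have "admissible T ?q ?v1 ?v2"
    unfolding admissible_def by blast
  moreover have "traj_length T ?v1 ?v2 = r"
  proof -
    have "r = (LINT t|distr (lebesgue_on {0..T}) (lebesgue_on {0..T}) (\<lambda>t. T - t).
        sqrt ((u1 t)\<^sup>2 - (u2 t)\<^sup>2))"
      by (simp add: r_eq traj_length_def distr_lebesgue_on_reflect)
    also have "\<dots> = traj_length T ?v1 ?v2"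
      unfolding traj_length_def by (rule integral_distr[OF refl]) (use u in measurable)
    finally show ?thesis ..
  qed
  moreover have "?q 0 = q0" "?q T = refl2 p"
    using q by (simp_all add: p reversal_linear_def refl2_def)
  ultimately show ?thesis
    unfolding traj_lengths_def by (smt (verit) mem_Collect_eq)
qed

section \<open>Symmetries of the distance\<close>

lemma dist_sL_refl2: "dist_sL (refl2 p) = dist_sL p"
proof -
  have le: "dist_sL p \<le> dist_sL (refl2 p)" for p
    using dist_sL_scale_le[of 1 p "refl2 p"] traj_lengths_refl2
    by (auto simp: refl2_def split: prod.splits simp flip: one_ereal_def)
  from le[of "refl2 p"] have "dist_sL (refl2 p) \<le> dist_sL p"
    by (simp add: refl2_def split: prod.splits)
  with le[of p] show ?thesis by (rule antisym[rotated])
qed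

lemma dist_sL_refl1: "dist_sL (refl1 p) = dist_sL p"
proof -
  \<comment> \<open>The planar map \<open>y \<mapsto> - y\<close> has determinant -1, so its lift
    flips z as well.\<close>
  have eq: "lift 1 0 0 (-1) p = refl1 (refl2 p)" for p
    by (auto simp: lift_def refl1_def refl2_def split: prod.splits)
  have "r \<in> traj_lengths (refl1 (refl2 p))" if "r \<in> traj_lengths p" for r p
    using traj_lengths_lift[where a = 1 and b = 0 and c = 0 and d = "-1" and k = 1] that by (simp add: eq)
  then have le: "dist_sL p \<le> dist_sL (refl1 (refl2 p))" for p
    using dist_sL_scale_le[of 1 p "refl1 (refl2 p)"]
    by (auto simp: refl1_def refl2_def split: prod.splits simp flip: one_ereal_def)
  have comm: "refl1 (refl2 p) = refl2 (refl1 p)" "refl1 (refl1 p) = p" for p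
    by (auto simp: refl1_def refl2_def split: prod.splits)
  have le': "dist_sL p \<le> dist_sL (refl1 p)" for p
    using le[of p] by (simp add: comm dist_sL_refl2)
  show ?thesis using le'[of p] le'[of "refl1 p"] by (simp add: comm antisym)
qed

lemma dist_sL_flow_X0: "dist_sL (flow X0 s p) = dist_sL p"
proof -
  have flow: "flow X0 s p = lift (cosh s) (sinh s) (sinh s) (cosh s) p" for s p
    by (cases p) (use cosh_square_eq[of s] in
        \<open>simp add: flow_X0 lift_def algebra_simps flip: power2_eq_square\<close>)
  have inv: "flow X0 (- s) (flow X0 s p) = p" for s p
    by (cases p) (use cosh_square_eq[of s] in
        \<open>simp add: flow_X0 algebra_simps power2_eq_square flip: distrib_left\<close>)
  have zero: "flow X0 s q0 = q0" for s
    by (simp add: flow_X0)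
  have cone: "cosh s * u + sinh s * v \<ge> \<bar>sinh s * u + cosh s * v\<bar>" if "u \<ge> \<bar>v\<bar>" for s u v :: real
  proof -
    \<comment> \<open>In the null coordinates \<open>u + v\<close> and \<open>u - v\<close> the
      rotation is multiplication by \<open>exp s\<close> and \<open>exp (- s)\<close>, and the cone
      is the quadrant where both are nonnegative.\<close>
    have "(cosh s + sinh s) * (u + v) \<ge> 0" "(cosh s - sinh s) * (u - v) \<ge> 0"
      using that by (auto simp: cosh_plus_sinh cosh_minus_sinh)
    then show ?thesis by (simp add: algebra_simps abs_le_iff)
  qed
  have conf: "(cosh s * u + sinh s * v)\<^sup>2 - (sinh s * u + cosh s * v)\<^sup>2 = 1\<^sup>2 * (u\<^sup>2 - v\<^sup>2)"
    for s u v :: real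
  proof -
    have "(cosh s * u + sinh s * v)\<^sup>2 - (sinh s * u + cosh s * v)\<^sup>2
        = ((cosh s)\<^sup>2 - (sinh s)\<^sup>2) * (u\<^sup>2 - v\<^sup>2)" by algebra
    then show ?thesis by (simp add: cosh_square_eq)
  qed
  have "r \<in> traj_lengths (flow X0 s p)" if "r \<in> traj_lengths p" for s r p
    using traj_lengths_lift[OF cone conf _ that, of s] by (simp add: flow)
  moreover have "p = q0 \<longleftrightarrow> flow X0 s p = q0" for s p
    using inv[of s p] zero by metis
  ultimately have le: "dist_sL p \<le> dist_sL (flow X0 s p)" for s p
    using dist_sL_scale_le[of 1 p "flow X0 s p"] by (simp flip: one_ereal_def)
  show ?thesis using le[of p s] le[of "flow X0 s p" "- s"] by (simp add: inv antisym)
qed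

lemma dist_sL_flow_Y: "dist_sL (flow Y s p) = ereal (exp s) * dist_sL p"
proof -
  have flow: "flow Y s p = lift (exp s) 0 0 (exp s) p" for s p
    by (cases p) (simp add: flow_Y lift_def flip: exp_add)
  have inv: "flow Y (- s) (flow Y s p) = p" for s p
    by (cases p) (simp add: flow_Y flip: exp_add)
  have zero: "flow Y s q0 = q0" for s
    by (simp add: flow_Y)
  have "exp s * r \<in> traj_lengths (flow Y s p)" if "r \<in> traj_lengths p" for s r p
    unfolding flow
    by (rule traj_lengths_lift) (use that in \<open>auto simp: abs_mult power_mult_distrib algebra_simps\<close>)
  moreover have "p = q0 \<longleftrightarrow> flow Y s p = q0" for s p
    using inv[of s p] zero by metis
  ultimately have le: "ereal (exp s) * dist_sL p \<le> dist_sL (flow Y s p)" for s p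
    by (intro dist_sL_scale_le) simp_all
  \<comment> \<open>Inserting \<open>exp s * exp (- s) = 1\<close> lets \<open>le\<close>, applied
    to the inverse dilation, give the reverse inequality.\<close>
  have "dist_sL (flow Y s p) = ereal (exp s) * (ereal (exp (- s)) * dist_sL (flow Y s p))"
    by (simp flip: mult.assoc exp_add one_ereal_def)
  also have "\<dots> \<le> ereal (exp s) * dist_sL p"
    using le[of "- s" "flow Y s p"] by (intro ereal_mult_left_mono) (simp_all add: inv)
  finally show ?thesis using le[of s p] by (rule antisym)
qed

theorem theorem12:
  shows "(\<forall>s::real. \<forall>q\<in>causal_future. dist_sL (flow X0 s q) = dist_sL q) \<and>
         (\<forall>q\<in>causal_future. dist_sL (refl1 q) = dist_sL q) \<and>
         (\<forall>q\<in>causal_future. dist_sL (refl2 q) = dist_sL q) \<and>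
         (\<forall>s::real. \<forall>q\<in>causal_future. dist_sL (flow Y s q) = ereal (exp s) * dist_sL q)"
  by (simp add: dist_sL_flow_X0 dist_sL_refl1 dist_sL_refl2 dist_sL_flow_Y)

end
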